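(* Let $(\Delta,X)$ be a simplicial complex and let $(\Delta^*,X)$ be its Alexander dual. Then: (1) if $(\Delta,X)$ is a combinatorial grape, then $(\Delta^*,X)$ is a combinatorial grape; (2) if $(\Delta,X)$ is a strong combinatorial grape, then $(\Delta^*,X)$ is a strong combinatorial grape; (3) if $(\Delta,X)$ is a weak combinatorial grape, then $(\Delta^*,X)$ is a weak combinatorial grape; (4) if $(\Delta,X)$ is a strong-weak combinatorial grape, then $(\Delta^*,X)$ is a strong-weak combinatorial grape.
   Context: A simplicial complex is a pair $(\Delta,X)$ (often written just $\Delta$), where $X$ is a finite set (the ground set) and $\Delta$ is a family of subsets of $X$ closed under taking subsets. Elements of $\Delta$ are faces; $x\in X$ is a vertex of $\Delta$ if $\{x\}\in\Delta$ (not every element of $X$ need be a vertex). The void complex has no faces; the irrelevant complex is $\{\emptyset\}$. The Alexander dual of $(\Delta,X)$ is $(\Delta^*,X)$ with $\Delta^*=\{F\subseteq X: X\setminus F\notin\Delta\}$. For $a\in X$, the deletion and link are the following simplicial complexes on the ground set $X\setminus\{a\}$: $\operatorname{dl}_a(\Delta)=\{\sigma\in\Delta: a\notin\sigma\}$ and $\operatorname{lk}_a(\Delta)=\{\sigma\in\Delta: a\notin\sigma,\ \sigma\cup\{a\}\in\Delta\}$. A complex on a ground set $Y$ is a cone with apex $x\in Y$ if it has the form $\{\sigma,\ \sigma\cup\{x\} : \sigma\in\Delta'\}$ for a simplicial complex $\Delta'$ none of whose faces contains $x$. In particular, the void complex is a cone with any apex $x\in Y$. Simple-homotopy: let $\sigma$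 be a maximal face of $\Delta$ and $\tau\subset\sigma$ with $|\tau|=|\sigma|-1$ ($\tau=\emptyset$ is allowed). If $\sigma$ is the only face of $\Delta$ properly containing $\tau$, then the removal of $\sigma$ and $\tau$ is an elementary collapse; the inverse operation is an elementary expansion. Two simplicial complexes are simple-homotopy equivalent if they are related by a sequence of elementary collapses and elementary expansions. The following classes are defined recursively. $(\Delta,X)$ is a - combinatorial grape if either (i) there is $a\in X$ such that $\operatorname{lk}_a(\Delta)$ is contained in a cone that is itself contained in $\operatorname{dl}_a(\Delta)$, and both $\operatorname{dl}_a(\Delta)$ and $\operatorname{lk}_a(\Delta)$ are combinatorial grapes, or (ii) $\Delta$ has at most one vertex; - strong combinatorial grape if either (i) there is $a\in X$ such that at least one of $\operatorname{lk}_a(\Delta)$ and $\operatorname{dl}_a(\Delta)$ is a cone, and both $\operatorname{dl}_a(\Delta)$ and $\operatorname{lk}_a(\Delta)$ are strong combinatorial grapes, or (ii) $\Delta$ has at most one vertex; - weak combinatorial grape if either (i) there are $a\in X$ and a simplicial complex $\Gamma$ such that $\operatorname{lk}_a(\Delta)\subseteq\Gamma\subseteq\operatorname{dl}_a(\Delta)$, $\Gamma$ is simple-homotopy equivalent to the void complex, and both $\operatorname{dl}_a(\Delta)$ and $\operatorname{lk}_a(\Delta)$ are weak combinatorial grapes, or (ii) $\Delta$ has at most one vertex; - strong-weak combinatorial grape if either (i) there is $a\in X$ such that at least one of $\operatorname{lk}_a(\Delta)$ and $\operatorname{dl}_a(\Delta)$ is simple-homotopy equivalent to the void complex, and both $\operatorname{dl}_a(\Delta)$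 and $\operatorname{lk}_a(\Delta)$ are strong-weak combinatorial grapes, or (ii) $\Delta$ has at most one vertex. *)

theory Defs
  imports Main
begin

text \<open>
  A simplicial complex is given by its family of faces \<open>\<Delta>\<close> together with its finite ground set \<open>X\<close>.
  Neither \<open>{} \<in> \<Delta>\<close> nor \<open>{x} \<in> \<Delta>\<close> for \<open>x \<in> X\<close> is required: \<open>{}\<close> is the void complex and \<open>{{}}\<close> the
  irrelevant one.
\<close>

definition simplicial_complex :: "'a set set \<Rightarrow> 'a set \<Rightarrow> bool" where
  "simplicial_complex \<Delta> X \<longleftrightarrow>
     finite X \<and> (\<forall>\<sigma>\<in>\<Delta>. \<sigma> \<subseteq> X) \<and> (\<forall>\<sigma>\<in>\<Delta>. \<forall>\<tau>. \<tau> \<subseteq> \<sigma> \<longrightarrow> \<tau> \<in> \<Delta>)"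

definition vertices :: "'a set set \<Rightarrow> 'a set \<Rightarrow> 'a set" where
  "vertices \<Delta> X = {x \<in> X. {x} \<in> \<Delta>}"

definition alexander_dual :: "'a set set \<Rightarrow> 'a set \<Rightarrow> 'a set set" where
  "alexander_dual \<Delta> X = {F. F \<subseteq> X \<and> X - F \<notin> \<Delta>}"

text \<open>Deletion and link of \<open>a\<close> in \<open>(\<Delta>, X)\<close> are always regarded as complexes on \<open>X - {a}\<close>.\<close>

definition deletion :: "'a \<Rightarrow> 'a set set \<Rightarrow> 'a set set" where
  "deletion a \<Delta> = {\<sigma> \<in> \<Delta>. a \<notin> \<sigma>}"

definition link :: "'a \<Rightarrow> 'a set set \<Rightarrow> 'a set set" where
  "link a \<Delta> = {\<sigma> \<in> \<Delta>. a \<notin> \<sigma> \<and> \<sigma> \<union> {a} \<in> \<Delta>}"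

text \<open>
  The apex must belong to the ground set \<open>Y\<close>, but need not be a vertex: taking \<open>\<Delta>' = {}\<close>, the void
  complex is a cone on every nonempty ground set.
\<close>

definition cone_with_apex :: "'a set set \<Rightarrow> 'a set \<Rightarrow> 'a \<Rightarrow> bool" where
  "cone_with_apex K Y x \<longleftrightarrow>
     x \<in> Y \<and>
     (\<exists>\<Delta>'. simplicial_complex \<Delta>' Y \<and> (\<forall>\<sigma>\<in>\<Delta>'. x \<notin> \<sigma>) \<and>
           K = \<Delta>' \<union> {\<sigma> \<union> {x} | \<sigma>. \<sigma> \<in> \<Delta>'})"

definition cone :: "'a set set \<Rightarrow> 'a set \<Rightarrow> bool" where
  "cone K Y \<longleftrightarrow> (\<exists>x. cone_with_apex K Y x)"

definition maximal_face :: "'a set \<Rightarrow> 'a set set \<Rightarrow> bool" where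
  "maximal_face \<sigma> K \<longleftrightarrow> \<sigma> \<in> K \<and> (\<forall>\<rho>\<in>K. \<sigma> \<subseteq> \<rho> \<longrightarrow> \<rho> = \<sigma>)"

text \<open>
  A collapse of \<open>(K, Y)\<close> to \<open>(L, Y)\<close> removes faces and keeps the ground set.  An expansion, being the
  inverse operation, keeps it too, so all complexes in a sequence of collapses and expansions
  share the ground set \<open>Y\<close>.  Since \<open>\<tau> = {}\<close> is allowed, a single point collapses to the void
  complex.
\<close>

definition elementary_collapse :: "'a set \<Rightarrow> 'a set set \<Rightarrow> 'a set set \<Rightarrow> bool" where
  "elementary_collapse Y K L \<longleftrightarrow>
     simplicial_complex K Y \<and>
     (\<exists>\<sigma> \<tau>. maximal_face \<sigma> K \<and> \<tau> \<subset> \<sigma> \<and> card \<sigma> = card \<tau> + 1 \<and>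
            (\<forall>\<rho>\<in>K. \<tau> \<subset> \<rho> \<longrightarrow> \<rho> = \<sigma>) \<and> L = K - {\<sigma>, \<tau>})"

definition simple_homotopy_equivalent :: "'a set \<Rightarrow> 'a set set \<Rightarrow> 'a set set \<Rightarrow> bool" where
  "simple_homotopy_equivalent Y K L \<longleftrightarrow>
     simplicial_complex K Y \<and> simplicial_complex L Y \<and> equivclp (elementary_collapse Y) K L"

inductive combinatorial_grape :: "'a set set \<Rightarrow> 'a set \<Rightarrow> bool" where
  step: "combinatorial_grape \<Delta> X"
    if "simplicial_complex \<Delta> X" and "a \<in> X"
      and "cone C (X - {a})" and "link a \<Delta> \<subseteq> C" and "C \<subseteq> deletion a \<Delta>"
      and "combinatorial_grape (deletion a \<Delta>) (X - {a})"
      and "combinatorial_grape (link a \<Delta>) (X - {a})"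
| base: "combinatorial_grape \<Delta> X"
    if "simplicial_complex \<Delta> X" and "card (vertices \<Delta> X) \<le> 1"

inductive strong_combinatorial_grape :: "'a set set \<Rightarrow> 'a set \<Rightarrow> bool" where
  step: "strong_combinatorial_grape \<Delta> X"
    if "simplicial_complex \<Delta> X" and "a \<in> X"
      and "cone (link a \<Delta>) (X - {a}) \<or> cone (deletion a \<Delta>) (X - {a})"
      and "strong_combinatorial_grape (deletion a \<Delta>) (X - {a})"
      and "strong_combinatorial_grape (link a \<Delta>) (X - {a})"
| base: "strong_combinatorial_grape \<Delta> X"
    if "simplicial_complex \<Delta> X" and "card (vertices \<Delta> X) \<le> 1"

inductive weak_combinatorial_grape :: "'a set set \<Rightarrow> 'a set \<Rightarrow> bool" where
  step: "weak_combinatorial_grape \<Delta> X"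
    if "simplicial_complex \<Delta> X" and "a \<in> X"
      and "simplicial_complex \<Gamma> (X - {a})" and "link a \<Delta> \<subseteq> \<Gamma>" and "\<Gamma> \<subseteq> deletion a \<Delta>"
      and "simple_homotopy_equivalent (X - {a}) \<Gamma> {}"
      and "weak_combinatorial_grape (deletion a \<Delta>) (X - {a})"
      and "weak_combinatorial_grape (link a \<Delta>) (X - {a})"
| base: "weak_combinatorial_grape \<Delta> X"
    if "simplicial_complex \<Delta> X" and "card (vertices \<Delta> X) \<le> 1"

inductive strong_weak_combinatorial_grape :: "'a set set \<Rightarrow> 'a set \<Rightarrow> bool" where
  step: "strong_weak_combinatorial_grape \<Delta> X"
    if "simplicial_complex \<Delta> X" and "a \<in> X"
      and "simple_homotopy_equivalent (X - {a}) (link a \<Delta>) {} \<or>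
           simple_homotopy_equivalent (X - {a}) (deletion a \<Delta>) {}"
      and "strong_weak_combinatorial_grape (deletion a \<Delta>) (X - {a})"
      and "strong_weak_combinatorial_grape (link a \<Delta>) (X - {a})"
| base: "strong_weak_combinatorial_grape \<Delta> X"
    if "simplicial_complex \<Delta> X" and "card (vertices \<Delta> X) \<le> 1"

end

theory Submission
  imports Defs
begin

text \<open>
  Alexander duality reverses inclusions, exchanges deletion and link, preserves cones, and turns the
  collapse removing \<open>\<sigma>\<close> and \<open>\<tau>\<close> into the expansion adding their complements.  Hence the recursive
  clauses dualise.  For a complex with at most one vertex on a ground set with at least two
  elements, pick a non-vertex \<open>a\<close>: its link is void, so the deletion of \<open>a\<close> in the dual is a full
  simplex, in particular a cone, and induction applies.
\<close>

subsection \<open>Deletion, link and duality\<close>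

lemma simplicial_complexI:
  assumes "finite Y" "\<And>\<sigma>. \<sigma> \<in> K \<Longrightarrow> \<sigma> \<subseteq> Y"
    and "\<And>\<sigma> \<tau>. \<sigma> \<in> K \<Longrightarrow> \<tau> \<subseteq> \<sigma> \<Longrightarrow> \<tau> \<in> K"
  shows "simplicial_complex K Y"
  using assms unfolding simplicial_complex_def by blast

lemma simplicial_complex_ground_finite: "simplicial_complex K Y \<Longrightarrow> finite Y"
  unfolding simplicial_complex_def by blast

lemma simplicial_complex_finite: "simplicial_complex K Y \<Longrightarrow> finite K"
  by (rule finite_subset[of K "Pow Y"]) (auto simp only: simplicial_complex_def finite_Pow_iff Pow_iff)

lemma simplicial_complex_closed:
  "simplicial_complex K Y \<Longrightarrow> \<sigma> \<in> K \<Longrightarrow> \<tau> \<subseteq> \<sigma> \<Longrightarrow> \<tau> \<in> K"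
  unfolding simplicial_complex_def by blast

lemma simplicial_complex_void: "finite Y \<Longrightarrow> simplicial_complex {} Y"
  by (simp add: simplicial_complex_def)

lemma simplicial_complex_deletion:
  assumes "simplicial_complex \<Delta> X"
  shows "simplicial_complex (deletion a \<Delta>) (X - {a})"
proof (rule simplicial_complexI)
  show "finite (X - {a})" using assms by (simp add: simplicial_complex_ground_finite)
  show "\<sigma> \<subseteq> X - {a}" if "\<sigma> \<in> deletion a \<Delta>" for \<sigma>
    using assms that unfolding simplicial_complex_def deletion_def by blast
  show "\<tau> \<in> deletion a \<Delta>" if "\<sigma> \<in> deletion a \<Delta>" "\<tau> \<subseteq> \<sigma>" for \<sigma> \<tau>
    using simplicial_complex_closed[OF assms _ that(2)] that unfolding deletion_def by blast
qed

lemma simplicial_complex_link: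
  assumes "simplicial_complex \<Delta> X"
  shows "simplicial_complex (link a \<Delta>) (X - {a})"
proof (rule simplicial_complexI)
  show "finite (X - {a})" using assms by (simp add: simplicial_complex_ground_finite)
  show "\<sigma> \<subseteq> X - {a}" if "\<sigma> \<in> link a \<Delta>" for \<sigma>
    using assms that unfolding simplicial_complex_def link_def by blast
  show "\<tau> \<in> link a \<Delta>" if "\<sigma> \<in> link a \<Delta>" "\<tau> \<subseteq> \<sigma>" for \<sigma> \<tau>
  proof -
    have "\<sigma> \<union> {a} \<in> \<Delta>" "a \<notin> \<tau>" using that unfolding link_def by auto
    then have "\<tau> \<in> \<Delta>" "\<tau> \<union> {a} \<in> \<Delta>"
      using that(2) by (auto intro: simplicial_complex_closed[OF assms])
    then show ?thesis using \<open>a \<notin> \<tau>\<close> unfolding link_def by simp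
  qed
qed

lemma link_subset_deletion: "link a \<Delta> \<subseteq> deletion a \<Delta>"
  unfolding link_def deletion_def by blast

lemma simplicial_complex_dual:
  assumes "simplicial_complex \<Delta> X"
  shows "simplicial_complex (alexander_dual \<Delta> X) X"
proof (rule simplicial_complexI)
  show "finite X" using assms by (rule simplicial_complex_ground_finite)
  show "\<sigma> \<subseteq> X" if "\<sigma> \<in> alexander_dual \<Delta> X" for \<sigma>
    using that unfolding alexander_dual_def by simp
  show "\<tau> \<in> alexander_dual \<Delta> X" if "\<sigma> \<in> alexander_dual \<Delta> X" "\<tau> \<subseteq> \<sigma>" for \<sigma> \<tau>
    using that simplicial_complex_closed[OF assms, of "X - \<tau>" "X - \<sigma>"]
    unfolding alexander_dual_def by auto
qed

lemma alexander_dual_antimono: "K \<subseteq> L \<Longrightarrow> alexander_dual L X \<subseteq> alexander_dual K X"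
  unfolding alexander_dual_def by blast

lemma alexander_dual_void: "alexander_dual {} X = Pow X"
  unfolding alexander_dual_def by blast

text \<open>The complement of \<open>F \<union> {a}\<close> in \<open>X\<close> is the complement of
  \<open>F\<close> in \<open>X - {a}\<close>; it avoids \<open>a\<close>, so testing it against
  \<open>\<Delta>\<close> or against the deletion is the same.\<close>

lemma link_alexander_dual:
  assumes "a \<in> X" "simplicial_complex \<Delta> X"
  shows "link a (alexander_dual \<Delta> X) = alexander_dual (deletion a \<Delta>) (X - {a})"
proof -
  \<comment> \<open>The link asks for both \<open>F\<close> and \<open>F \<union> {a}\<close> to be
    faces of the dual; the second condition implies the first because \<open>X - F\<close> is the
    larger complement.\<close>
  have "X - F \<notin> \<Delta>" if "X - (F \<union> {a}) \<notin> \<Delta>" for F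
    using simplicial_complex_closed[OF assms(2), of "X - F" "X - (F \<union> {a})"] that by blast
  moreover have "X - {a} - F = X - (F \<union> {a})" for F by blast
  ultimately show ?thesis
    using assms(1) unfolding link_def alexander_dual_def deletion_def by auto
qed

text \<open>If \<open>F\<close> avoids \<open>a\<close>, then \<open>X - F\<close> contains
  \<open>a\<close>, so it is a face of \<open>\<Delta>\<close> exactly when removing
  \<open>a\<close> from it leaves a face of the link.\<close>

lemma deletion_alexander_dual:
  assumes "a \<in> X" "simplicial_complex \<Delta> X"
  shows "deletion a (alexander_dual \<Delta> X) = alexander_dual (link a \<Delta>) (X - {a})"
proof -
  have "X - {a} - F \<in> link a \<Delta> \<longleftrightarrow> X - F \<in> \<Delta>" if "a \<notin> F" for F
  proof -
    have "(X - {a} - F) \<union> {a} = X - F" using that assms(1) by blast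
    moreover have "X - {a} - F \<in> \<Delta>" if "X - F \<in> \<Delta>"
      using simplicial_complex_closed[OF assms(2) that, of "X - {a} - F"] by blast
    ultimately show ?thesis unfolding link_def by auto
  qed
  then show ?thesis
    unfolding deletion_def alexander_dual_def by blast
qed

subsection \<open>Cones\<close>

text \<open>Trades the existential base for closure under inserting the apex, a form that can be
  checked directly on duals and after a collapse.\<close>

lemma cone_with_apex_iff:
  "cone_with_apex K Y x \<longleftrightarrow> x \<in> Y \<and> simplicial_complex K Y \<and> (\<forall>\<sigma>\<in>K. insert x \<sigma> \<in> K)"
proof
  assume "cone_with_apex K Y x"
  then obtain D where D: "x \<in> Y" "simplicial_complex D Y" "\<forall>\<sigma>\<in>D. x \<notin> \<sigma>"
    "K = D \<union> {\<sigma> \<union> {x} | \<sigma>. \<sigma> \<in> D}"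
    unfolding cone_with_apex_def by blast
  have sub: "\<sigma> \<subseteq> Y" if "\<sigma> \<in> D" for \<sigma>
    using D(2) that unfolding simplicial_complex_def by blast
  \<comment> \<open>Membership in \<open>K\<close> is decided by the part away from
    \<open>x\<close>, so closure under subsets is inherited from \<open>D\<close>.\<close>
  have K: "\<sigma> \<in> K \<longleftrightarrow> \<sigma> - {x} \<in> D \<and> \<sigma> \<subseteq> Y" for \<sigma>
  proof
    assume "\<sigma> \<in> K"
    then consider "\<sigma> \<in> D" | \<rho> where "\<rho> \<in> D" "\<sigma> = \<rho> \<union> {x}" using D(4) by blast
    then show "\<sigma> - {x} \<in> D \<and> \<sigma> \<subseteq> Y"
    proof cases
      case 1
      then show ?thesis using D(3) sub by simp
    next
      case 2
      then have "\<sigma> - {x} = \<rho>" using D(3) by auto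
      then show ?thesis using 2 D(1) sub by auto
    qed
  next
    assume *: "\<sigma> - {x} \<in> D \<and> \<sigma> \<subseteq> Y"
    show "\<sigma> \<in> K"
    proof (cases "x \<in> \<sigma>")
      case True
      then have "\<sigma> = (\<sigma> - {x}) \<union> {x}" by blast
      then show ?thesis using * D(4) by blast
    next
      case False
      then show ?thesis using * D(4) by simp
    qed
  qed
  have "simplicial_complex K Y"
  proof (rule simplicial_complexI)
    show "finite Y" using D(2) by (rule simplicial_complex_ground_finite)
    show "\<sigma> \<subseteq> Y" if "\<sigma> \<in> K" for \<sigma> using that K by simp
    show "\<tau> \<in> K" if "\<sigma> \<in> K" "\<tau> \<subseteq> \<sigma>" for \<sigma> \<tau>
      using that K simplicial_complex_closed[OF D(2), of "\<sigma> - {x}" "\<tau> - {x}"] by blast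
  qed
  moreover have "\<forall>\<sigma>\<in>K. insert x \<sigma> \<in> K" using D(1) by (auto simp: K)
  ultimately show "x \<in> Y \<and> simplicial_complex K Y \<and> (\<forall>\<sigma>\<in>K. insert x \<sigma> \<in> K)"
    using D(1) by blast
next
  assume *: "x \<in> Y \<and> simplicial_complex K Y \<and> (\<forall>\<sigma>\<in>K. insert x \<sigma> \<in> K)"
  \<comment> \<open>The base is recovered as the faces that miss the apex.\<close>
  let ?D = "{\<sigma> \<in> K. x \<notin> \<sigma>}"
  have "simplicial_complex ?D Y" using * unfolding simplicial_complex_def by blast
  moreover have "K = ?D \<union> {\<sigma> \<union> {x} | \<sigma>. \<sigma> \<in> ?D}"
  proof (intro equalityI subsetI)
    fix \<sigma> assume \<sigma>: "\<sigma> \<in> K"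
    show "\<sigma> \<in> ?D \<union> {\<sigma> \<union> {x} | \<sigma>. \<sigma> \<in> ?D}"
    proof (cases "x \<in> \<sigma>")
      case True
      then have "\<sigma> = (\<sigma> - {x}) \<union> {x}" by blast
      moreover have "\<sigma> - {x} \<in> ?D"
        using \<sigma> * unfolding simplicial_complex_def by blast
      ultimately show ?thesis by blast
    qed (use \<sigma> in blast)
  qed (use * in auto)
  ultimately show "cone_with_apex K Y x"
    using * unfolding cone_with_apex_def by blast
qed

lemma cone_iff:
  "cone K Y \<longleftrightarrow> (\<exists>x\<in>Y. simplicial_complex K Y \<and> (\<forall>\<sigma>\<in>K. insert x \<sigma> \<in> K))"
  unfolding cone_def cone_with_apex_iff by blast

text \<open>The same apex works: if the complement of \<open>insert x F\<close> were a face of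
  \<open>K\<close>, inserting \<open>x\<close> would give a face containing \<open>Y - F\<close>,
  contradicting that \<open>F\<close> is in the dual.\<close>

lemma cone_alexander_dual:
  assumes "cone K Y"
  shows "cone (alexander_dual K Y) Y"
proof -
  from assms obtain x where x: "x \<in> Y" "simplicial_complex K Y" "\<forall>\<sigma>\<in>K. insert x \<sigma> \<in> K"
    unfolding cone_iff by blast
  have "insert x F \<in> alexander_dual K Y" if "F \<in> alexander_dual K Y" for F
  proof -
    have "Y - F \<subseteq> insert x (Y - insert x F)" by blast
    then have "Y - insert x F \<notin> K"
      using x(2,3) that unfolding alexander_dual_def simplicial_complex_def by blast
    then show ?thesis using that x(1) unfolding alexander_dual_def by blast
  qed
  then show ?thesis
    using x simplicial_complex_dual unfolding cone_iff by blast
qed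

lemma cone_Pow: "finite Y \<Longrightarrow> Y \<noteq> {} \<Longrightarrow> cone (Pow Y) Y"
  unfolding cone_iff simplicial_complex_def by auto

subsection \<open>Simple homotopy\<close>

lemma simplicial_complex_collapse:
  assumes "elementary_collapse Y K L"
  shows "simplicial_complex L Y"
proof (rule simplicial_complexI)
  from assms obtain \<sigma> \<tau> where K: "simplicial_complex K Y" and \<sigma>: "maximal_face \<sigma> K"
    and \<tau>: "\<tau> \<subset> \<sigma>" "\<forall>\<rho>\<in>K. \<tau> \<subset> \<rho> \<longrightarrow> \<rho> = \<sigma>"
    and L: "L = K - {\<sigma>, \<tau>}"
    unfolding elementary_collapse_def by blast
  show "finite Y" using K by (rule simplicial_complex_ground_finite)
  show "\<rho> \<subseteq> Y" if "\<rho> \<in> L" for \<rho>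
    using K that unfolding simplicial_complex_def L by blast
  show "\<rho> \<in> L" if \<rho>: "\<rho>' \<in> L" "\<rho> \<subseteq> \<rho>'" for \<rho> \<rho>'
  proof -
    have \<rho>': "\<rho>' \<in> K" "\<rho>' \<noteq> \<sigma>" "\<rho>' \<noteq> \<tau>" using \<rho>(1) unfolding L by auto
    \<comment> \<open>Only \<open>\<sigma>\<close> and \<open>\<tau>\<close> itself contain
      \<open>\<tau>\<close>, so a surviving face does not, and none of its subsets can be one of the
      two removed faces.\<close>
    then have "\<not> \<tau> \<subseteq> \<rho>'" using \<tau>(2) by blast
    then have "\<rho> \<noteq> \<sigma>" "\<rho> \<noteq> \<tau>" using \<rho>(2) \<tau>(1) by blast+
    then show ?thesis
      using simplicial_complex_closed[OF K \<rho>'(1) \<rho>(2)] unfolding L by simp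
  qed
qed

text \<open>Faces pair off as \<open>\<sigma>\<close> and \<open>\<sigma> - {x}\<close>. Removing
  the pair of a maximal face is a collapse that leaves a smaller cone with the same apex; the last
  pair is \<open>{x}\<close> and \<open>{}\<close>.\<close>

lemma cone_equivclp_void:
  assumes "cone K Y"
  shows "equivclp (elementary_collapse Y) K {}"
proof -
  from assms obtain x where x: "x \<in> Y" "simplicial_complex K Y" "\<forall>\<sigma>\<in>K. insert x \<sigma> \<in> K"
    unfolding cone_iff by blast
  from simplicial_complex_finite[OF x(2)] x show ?thesis
  proof (induction K rule: finite_psubset_induct)
    case (psubset K)
    show ?case
    proof (cases "K = {}")
      case True
      then show ?thesis by simp
    next
      case False
      then obtain \<sigma> where \<sigma>: "\<sigma> \<in> K" "\<And>\<rho>. \<rho> \<in> K \<Longrightarrow> \<sigma> \<subseteq> \<rho> \<Longrightarrow> \<sigma> = \<rho>"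
        using finite_has_maximal[OF psubset.hyps(1)] by metis
      \<comment> \<open>Inserting the apex gives a face again, and maximality forbids it to be
        larger.\<close>
      have x\<sigma>: "x \<in> \<sigma>" using \<sigma> psubset.prems(3) by blast
      let ?\<tau> = "\<sigma> - {x}" let ?L = "K - {\<sigma>, \<sigma> - {x}}"
      \<comment> \<open>Freeness of \<open>?\<tau>\<close>: a face above it, once the apex is
        inserted, contains the maximal face \<open>\<sigma>\<close> and hence equals it.\<close>
      have up: "\<rho> = \<sigma> \<or> \<rho> = ?\<tau>" if "\<rho> \<in> K" "?\<tau> \<subseteq> \<rho>" for \<rho>
      proof -
        have "\<sigma> \<subseteq> insert x \<rho>" using that by blast
        then have "\<sigma> = insert x \<rho>" using \<sigma>(2) psubset.prems(3) that(1) by blast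
        then show ?thesis using that(2) by blast
      qed
      have "\<sigma> \<subseteq> Y" "finite Y"
        using \<sigma>(1) psubset.prems(2) unfolding simplicial_complex_def by blast+
      then have "finite \<sigma>" by (rule finite_subset)
      then have "card \<sigma> = card ?\<tau> + 1" using x\<sigma> card_Suc_Diff1 by fastforce
      moreover have "maximal_face \<sigma> K" using \<sigma> unfolding maximal_face_def by blast
      moreover have "?\<tau> \<subset> \<sigma>" using x\<sigma> by blast
      moreover have "\<forall>\<rho>\<in>K. ?\<tau> \<subset> \<rho> \<longrightarrow> \<rho> = \<sigma>" using up by blast
      ultimately have collapse: "elementary_collapse Y K ?L"
        using psubset.prems(2) unfolding elementary_collapse_def by blast
      have "equivclp (elementary_collapse Y) ?L {}"
      proof (rule psubset.IH)
        show "?L \<subset> K" using \<sigma>(1) by blast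
        show "x \<in> Y" by fact
        show "simplicial_complex ?L Y" by (rule simplicial_complex_collapse[OF collapse])
        \<comment> \<open>If inserting \<open>x\<close> produced \<open>\<sigma>\<close>, the
          surviving face would contain \<open>?\<tau>\<close>; it cannot produce
          \<open>?\<tau>\<close>, which misses \<open>x\<close>.\<close>
        show "\<forall>\<rho>\<in>?L. insert x \<rho> \<in> ?L"
        proof
          fix \<rho> assume \<rho>: "\<rho> \<in> ?L"
          then have "\<not> ?\<tau> \<subseteq> \<rho>" using up by blast
          then have "insert x \<rho> \<noteq> \<sigma>" "insert x \<rho> \<noteq> ?\<tau>" by auto
          then show "insert x \<rho> \<in> ?L" using \<rho> psubset.prems(3) by simp
        qed
      qed
      then show ?thesis
        using collapse by (metis equivclp_trans r_into_equivclp)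
    qed
  qed
qed

lemma cone_simple_homotopy_equivalent_void:
  assumes "cone K Y"
  shows "simple_homotopy_equivalent Y K {}"
proof -
  have K: "simplicial_complex K Y" using assms unfolding cone_iff by blast
  then have "simplicial_complex {} Y"
    by (intro simplicial_complex_void simplicial_complex_ground_finite)
  with K cone_equivclp_void[OF assms] show ?thesis
    unfolding simple_homotopy_equivalent_def by blast
qed

text \<open>Complementation swaps the roles of the pair: \<open>Y - \<tau>\<close> becomes the
  maximal face and \<open>Y - \<sigma>\<close> its free face. The direction of the collapse is
  reversed because the dual of the smaller complex is the larger one.\<close>

lemma elementary_collapse_dual:
  assumes "elementary_collapse Y K L"
  shows "elementary_collapse Y (alexander_dual L Y) (alexander_dual K Y)"
proof -
  from assms obtain \<sigma> \<tau> where K: "simplicial_complex K Y" and \<sigma>: "maximal_face \<sigma> K"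
    and \<tau>: "\<tau> \<subset> \<sigma>" "card \<sigma> = card \<tau> + 1" "\<And>\<rho>. \<rho> \<in> K \<Longrightarrow> \<tau> \<subset> \<rho> \<Longrightarrow> \<rho> = \<sigma>"
    and L: "L = K - {\<sigma>, \<tau>}"
    unfolding elementary_collapse_def by blast
  have closed: "\<rho> \<in> K" if "\<rho>' \<in> K" "\<rho> \<subseteq> \<rho>'" for \<rho> \<rho>'
    using K that unfolding simplicial_complex_def by blast
  have sub: "\<sigma> \<in> K" "\<tau> \<in> K" "\<sigma> \<subseteq> Y" "\<tau> \<subseteq> Y" "finite Y"
    using \<sigma> \<tau>(1) K unfolding maximal_face_def simplicial_complex_def by blast+
  have "simplicial_complex (alexander_dual L Y) Y"
    using assms by (intro simplicial_complex_dual simplicial_complex_collapse)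
  moreover have dualL: "F \<in> alexander_dual L Y \<longleftrightarrow> F \<in> alexander_dual K Y \<or> F = Y - \<sigma> \<or> F = Y - \<tau>" for F
    using sub unfolding alexander_dual_def L by blast
  have notK: "Y - \<sigma> \<notin> alexander_dual K Y" "Y - \<tau> \<notin> alexander_dual K Y"
    using sub unfolding alexander_dual_def by (auto simp: double_diff)
  \<comment> \<open>The complement of such an \<open>F\<close> is a proper subset of
    \<open>\<sigma>\<close>, hence a face of \<open>K\<close>, but not of \<open>L\<close>; the only
    such face is \<open>\<tau>\<close>.\<close>
  have top: "F = Y - \<tau>" if "F \<in> alexander_dual L Y" "Y - \<sigma> \<subset> F" for F
  proof -
    have "Y - F \<subset> \<sigma>" "F \<subseteq> Y" using that sub unfolding alexander_dual_def by blast+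
    then have "Y - F \<in> K" "Y - F \<noteq> \<sigma>" using closed sub(1) by blast+
    moreover have "Y - F \<notin> L" using that(1) unfolding alexander_dual_def by blast
    ultimately have "Y - F = \<tau>" unfolding L by blast
    then show ?thesis using \<open>F \<subseteq> Y\<close> by blast
  qed
  moreover have psub: "Y - \<sigma> \<subset> Y - \<tau>" using \<tau>(1) sub(3) by blast
  moreover have "maximal_face (Y - \<tau>) (alexander_dual L Y)"
    unfolding maximal_face_def
  proof (intro conjI ballI impI)
    show "Y - \<tau> \<in> alexander_dual L Y" by (simp add: dualL)
    show "F = Y - \<tau>" if "F \<in> alexander_dual L Y" "Y - \<tau> \<subseteq> F" for F
      using top[OF that(1)] psub that(2) by (meson psubset_subset_trans)
  qed
  moreover have "card (Y - \<tau>) = card (Y - \<sigma>) + 1"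
  proof -
    \<comment> \<open>The bound on \<open>card \<sigma>\<close> keeps the subtraction of naturals
      from truncating.\<close>
    have "card (Y - \<tau>) = card Y - card \<tau>" "card (Y - \<sigma>) = card Y - card \<sigma>" "card \<sigma> \<le> card Y"
      using sub by (auto intro!: card_Diff_subset card_mono intro: finite_subset)
    then show ?thesis using \<tau>(2) by linarith
  qed
  moreover have "alexander_dual K Y = alexander_dual L Y - {Y - \<tau>, Y - \<sigma>}"
    using dualL notK by blast
  ultimately show ?thesis unfolding elementary_collapse_def by blast
qed

text \<open>Each step changes direction under duality, which the equivalence closure
  absorbs.\<close>

lemma equivclp_elementary_collapse_dual:
  assumes "equivclp (elementary_collapse Y) K L"
  shows "equivclp (elementary_collapse Y) (alexander_dual K Y) (alexander_dual L Y)"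
  using assms
proof (induction rule: equivclp_induct)
  case base
  show ?case by simp
next
  case (step L M)
  then show ?case
    by (meson elementary_collapse_dual equivclp_into_equivclp)
qed

text \<open>
  The hypothesis \<open>Y \<noteq> {}\<close> is essential: on the empty ground set the dual of the void complex is the
  irrelevant complex, which admits no collapse.
\<close>

lemma simple_homotopy_equivalent_void_dual:
  assumes "simple_homotopy_equivalent Y K {}" "Y \<noteq> {}"
  shows "simple_homotopy_equivalent Y (alexander_dual K Y) {}"
proof -
  have K: "simplicial_complex K Y" "simplicial_complex {} Y" "equivclp (elementary_collapse Y) K {}"
    using assms(1) unfolding simple_homotopy_equivalent_def by blast+
  \<comment> \<open>The dual of \<open>K\<close> is equivalent to the dual of the void complex, the
    full simplex \<open>Pow Y\<close>; this is a cone since \<open>Y\<close> is nonempty, and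
    therefore collapses to the void complex.\<close>
  have "finite Y" using K(1) by (rule simplicial_complex_ground_finite)
  then have "cone (Pow Y) Y" using assms(2) by (rule cone_Pow)
  then have "equivclp (elementary_collapse Y) (Pow Y) {}" by (rule cone_equivclp_void)
  with equivclp_elementary_collapse_dual[OF K(3)]
  have "equivclp (elementary_collapse Y) (alexander_dual K Y) {}"
    unfolding alexander_dual_void by (rule equivclp_trans)
  then show ?thesis
    using K(2) simplicial_complex_dual[OF K(1)]
    unfolding simple_homotopy_equivalent_def by blast
qed

subsection \<open>Grapes\<close>

lemma strong_imp_combinatorial_grape:
  "strong_combinatorial_grape \<Delta> X \<Longrightarrow> combinatorial_grape \<Delta> X"
proof (induction rule: strong_combinatorial_grape.induct)
  case (step \<Delta> X a)
  \<comment> \<open>Take for \<open>C\<close> whichever of link and deletion is a cone; the link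
    always lies in the deletion.\<close>
  from step.hyps(3) obtain C where "cone C (X - {a})" "link a \<Delta> \<subseteq> C" "C \<subseteq> deletion a \<Delta>"
    using link_subset_deletion[of a \<Delta>] by blast
  then show ?case
    by (rule combinatorial_grape.step[OF step.hyps(1,2) _ _ _ step.IH])
qed (rule combinatorial_grape.base)

lemma strong_imp_strong_weak_combinatorial_grape:
  "strong_combinatorial_grape \<Delta> X \<Longrightarrow> strong_weak_combinatorial_grape \<Delta> X"
proof (induction rule: strong_combinatorial_grape.induct)
  case (step \<Delta> X a)
  from step.hyps(3) show ?case
    by (intro strong_weak_combinatorial_grape.step[OF step.hyps(1,2) _ step.IH])
      (auto intro: cone_simple_homotopy_equivalent_void)
qed (rule strong_weak_combinatorial_grape.base)

lemma strong_weak_imp_weak_combinatorial_grape: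
  "strong_weak_combinatorial_grape \<Delta> X \<Longrightarrow> weak_combinatorial_grape \<Delta> X"
proof (induction rule: strong_weak_combinatorial_grape.induct)
  case (step \<Delta> X a)
  \<comment> \<open>Again \<open>\<Gamma>\<close> is the link or the deletion, whichever is
    equivalent to the void complex.\<close>
  from step.hyps(3) obtain \<Gamma> where "simple_homotopy_equivalent (X - {a}) \<Gamma> {}"
    "link a \<Delta> \<subseteq> \<Gamma>" "\<Gamma> \<subseteq> deletion a \<Delta>"
    using link_subset_deletion[of a \<Delta>] by blast
  moreover from this(1) have "simplicial_complex \<Gamma> (X - {a})"
    unfolding simple_homotopy_equivalent_def by blast
  ultimately show ?case
    using weak_combinatorial_grape.step[OF step.hyps(1,2) _ _ _ _ step.IH] by blast
qed (rule weak_combinatorial_grape.base)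

section \<open>Duals of complexes with at most one vertex\<close>

lemma card_vertices_le: "finite X \<Longrightarrow> card (vertices \<Delta> X) \<le> card X"
  unfolding vertices_def by (rule card_mono) auto

text \<open>The base clause is not self-dual: the dual can have many vertices and must be
  decomposed. Doing this in the strong class settles the base case of all four dualities through the
  inclusions above.\<close>

lemma strong_combinatorial_grape_dual_of_few_vertices:
  assumes "simplicial_complex \<Delta> X" "card (vertices \<Delta> X) \<le> 1"
  shows "strong_combinatorial_grape (alexander_dual \<Delta> X) X"
proof -
  have "finite X" using assms(1) by (rule simplicial_complex_ground_finite)
  then show ?thesis using assms
  proof (induction X arbitrary: \<Delta> rule: finite_psubset_induct)
    case (psubset X)
    note \<Delta> = psubset.prems(1)
    have dual: "simplicial_complex (alexander_dual \<Delta> X) X"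
      using \<Delta> by (rule simplicial_complex_dual)
    show ?case
    proof (cases "card X \<le> 1")
      case True
      then have "card (vertices (alexander_dual \<Delta> X) X) \<le> 1"
        using card_vertices_le[OF psubset.hyps] le_trans by blast
      then show ?thesis by (rule strong_combinatorial_grape.base[OF dual])
    next
      case False
      \<comment> \<open>At least two ground elements but at most one vertex, so some element is not
        a vertex.\<close>
      then have "vertices \<Delta> X \<noteq> X" using psubset.prems(2) by auto
      then obtain a where a: "a \<in> X" "{a} \<notin> \<Delta>" unfolding vertices_def by blast
      have lk: "link a \<Delta> = {}"
        using a(2) \<Delta> unfolding link_def simplicial_complex_def by blast
      have less: "X - {a} \<subset> X" using a(1) by blast
      have "X - {a} \<noteq> {}"
        using False card_mono[of "{a}" X] by auto
      then have "cone (deletion a (alexander_dual \<Delta> X)) (X - {a})"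
        using psubset.hyps
        unfolding deletion_alexander_dual[OF a(1) \<Delta>] lk alexander_dual_void
        by (intro cone_Pow) auto
      \<comment> \<open>This deletion is the dual of the void complex on \<open>X - {a}\<close>,
        which has no vertices, so the induction hypothesis covers it.\<close>
      moreover have "strong_combinatorial_grape (deletion a (alexander_dual \<Delta> X)) (X - {a})"
        unfolding deletion_alexander_dual[OF a(1) \<Delta>] lk
        using psubset.hyps
        by (intro psubset.IH[OF less] simplicial_complex_void) (auto simp: vertices_def)
      moreover have "strong_combinatorial_grape (link a (alexander_dual \<Delta> X)) (X - {a})"
        unfolding link_alexander_dual[OF a(1) \<Delta>]
      proof (intro psubset.IH[OF less] simplicial_complex_deletion \<Delta>)
        have "card (vertices (deletion a \<Delta>) (X - {a})) \<le> card (vertices \<Delta> X)"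
          using psubset.hyps by (intro card_mono) (auto simp: vertices_def deletion_def)
        then show "card (vertices (deletion a \<Delta>) (X - {a})) \<le> 1" using psubset.prems(2) by simp
      qed
      ultimately show ?thesis
        using strong_combinatorial_grape.step[OF dual a(1)] by blast
    qed
  qed
qed

section \<open>Dualising the recursive clauses\<close>

lemma combinatorial_grape_dual:
  "combinatorial_grape \<Delta> X \<Longrightarrow> combinatorial_grape (alexander_dual \<Delta> X) X"
proof (induction rule: combinatorial_grape.induct)
  case (step \<Delta> X a C)
  note eqs = link_alexander_dual[OF step.hyps(2,1)] deletion_alexander_dual[OF step.hyps(2,1)]
  show ?case
  \<comment> \<open>Dualising the chain from link through \<open>C\<close> to deletion reverses it;
    as link and deletion are also exchanged, the dual of \<open>C\<close> again lies between
    them.\<close>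
  proof (rule combinatorial_grape.step[where a = a and C = "alexander_dual C (X - {a})"],
      unfold eqs)
    show "simplicial_complex (alexander_dual \<Delta> X) X"
      using step.hyps(1) by (rule simplicial_complex_dual)
    show "cone (alexander_dual C (X - {a})) (X - {a})"
      using step.hyps(3) by (rule cone_alexander_dual)
  qed (rule step.hyps step.IH alexander_dual_antimono[OF step.hyps(4)]
      alexander_dual_antimono[OF step.hyps(5)])+
next
  case (base \<Delta> X)
  then show ?case
    by (intro strong_imp_combinatorial_grape strong_combinatorial_grape_dual_of_few_vertices)
qed

text \<open>The cone condition is symmetric in link and deletion, so their exchange only swaps the
  disjuncts.\<close>

lemma strong_combinatorial_grape_dual:
  "strong_combinatorial_grape \<Delta> X \<Longrightarrow> strong_combinatorial_grape (alexander_dual \<Delta> X) X"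
proof (induction rule: strong_combinatorial_grape.induct)
  case (step \<Delta> X a)
  note eqs = link_alexander_dual[OF step.hyps(2,1)] deletion_alexander_dual[OF step.hyps(2,1)]
  show ?case
  proof (rule strong_combinatorial_grape.step[where a = a], unfold eqs)
    show "cone (alexander_dual (deletion a \<Delta>) (X - {a})) (X - {a}) \<or>
        cone (alexander_dual (link a \<Delta>) (X - {a})) (X - {a})"
      using step.hyps(3) cone_alexander_dual by blast
  qed (rule step.hyps step.IH simplicial_complex_dual[OF step.hyps(1)])+
qed (rule strong_combinatorial_grape_dual_of_few_vertices)

lemma weak_combinatorial_grape_dual:
  "weak_combinatorial_grape \<Delta> X \<Longrightarrow> weak_combinatorial_grape (alexander_dual \<Delta> X) X"
proof (induction rule: weak_combinatorial_grape.induct)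
  case (step \<Delta> X a \<Gamma>)
  note eqs = link_alexander_dual[OF step.hyps(2,1)] deletion_alexander_dual[OF step.hyps(2,1)]
  show ?case
  proof (cases "X - {a} = {}")
    \<comment> \<open>Over the empty ground set equivalence to the void complex does not dualise.
      Here \<open>X = {a}\<close>, so the dual has at most one vertex and falls under the base
      clause.\<close>
    case True
    then have "X = {a}" using step.hyps(2) by blast
    then have "card (vertices (alexander_dual \<Delta> X) X) \<le> 1"
      using card_vertices_le[of X "alexander_dual \<Delta> X"] by simp
    then show ?thesis
      by (rule weak_combinatorial_grape.base[OF simplicial_complex_dual[OF step.hyps(1)]])
  next
    case False
    show ?thesis
    proof (rule weak_combinatorial_grape.step[where a = a and \<Gamma> = "alexander_dual \<Gamma> (X - {a})"],
        unfold eqs)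
      show "simple_homotopy_equivalent (X - {a}) (alexander_dual \<Gamma> (X - {a})) {}"
        using step.hyps(6) False by (rule simple_homotopy_equivalent_void_dual)
    qed (rule step.hyps step.IH simplicial_complex_dual[OF step.hyps(1)]
        simplicial_complex_dual[OF step.hyps(3)] alexander_dual_antimono[OF step.hyps(4)]
        alexander_dual_antimono[OF step.hyps(5)])+
  qed
next
  case (base \<Delta> X)
  then show ?case
    by (intro strong_weak_imp_weak_combinatorial_grape strong_imp_strong_weak_combinatorial_grape
        strong_combinatorial_grape_dual_of_few_vertices)
qed

text \<open>Exchanging link and deletion swaps the disjuncts, as for strong grapes; a one-point
  ground set is again left to the base clause.\<close>

lemma strong_weak_combinatorial_grape_dual:
  "strong_weak_combinatorial_grape \<Delta> X \<Longrightarrow> strong_weak_combinatorial_grape (alexander_dual \<Delta> X) X"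
proof (induction rule: strong_weak_combinatorial_grape.induct)
  case (step \<Delta> X a)
  note eqs = link_alexander_dual[OF step.hyps(2,1)] deletion_alexander_dual[OF step.hyps(2,1)]
  show ?case
  proof (cases "X - {a} = {}")
    case True
    then have "X = {a}" using step.hyps(2) by blast
    then have "card (vertices (alexander_dual \<Delta> X) X) \<le> 1"
      using card_vertices_le[of X "alexander_dual \<Delta> X"] by simp
    then show ?thesis
      by (rule strong_weak_combinatorial_grape.base[OF simplicial_complex_dual[OF step.hyps(1)]])
  next
    case False
    show ?thesis
    proof (rule strong_weak_combinatorial_grape.step[where a = a], unfold eqs)
      show "simple_homotopy_equivalent (X - {a}) (alexander_dual (deletion a \<Delta>) (X - {a})) {} \<or>
          simple_homotopy_equivalent (X - {a}) (alexander_dual (link a \<Delta>) (X - {a})) {}"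
        using step.hyps(3) simple_homotopy_equivalent_void_dual[OF _ False] by blast
    qed (rule step.hyps step.IH simplicial_complex_dual[OF step.hyps(1)])+
  qed
next
  case (base \<Delta> X)
  then show ?case
    by (intro strong_imp_strong_weak_combinatorial_grape
        strong_combinatorial_grape_dual_of_few_vertices)
qed

theorem theorem5p2:
  fixes \<Delta> :: "'a set set" and X :: "'a set"
  assumes "simplicial_complex \<Delta> X"
  shows "(combinatorial_grape \<Delta> X \<longrightarrow> combinatorial_grape (alexander_dual \<Delta> X) X) \<and>
         (strong_combinatorial_grape \<Delta> X \<longrightarrow> strong_combinatorial_grape (alexander_dual \<Delta> X) X) \<and>
         (weak_combinatorial_grape \<Delta> X \<longrightarrow> weak_combinatorial_grape (alexander_dual \<Delta> X) X) \<and>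
         (strong_weak_combinatorial_grape \<Delta> X \<longrightarrow> strong_weak_combinatorial_grape (alexander_dual \<Delta> X) X)"
  using combinatorial_grape_dual strong_combinatorial_grape_dual weak_combinatorial_grape_dual
    strong_weak_combinatorial_grape_dual by blast

end
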